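(* Let $L\in\mathbb N$, ${\bf A}\in\mathbb R^{M\times N}$, ${\bf b}\in\mathbb R^M$, $\tilde\eta>0$, and let $(r,{\bf u})$ follow the weight-normalized gradient flow with learning rates $(\eta_r,\eta_{\bf u})=(\tilde\eta,1)$, $\|{\bf u}_0\|_2=1$, and ${\bf u}(t)>0$ entrywise for all $t\ge0$ (this holds e.g. if $L\ge2$, $r_0>0$, ${\bf u}_0>0$). Then the quantity $$h_{\tilde\eta}(t):=(I-{\bf A}^\dagger{\bf A})\cdot\begin{cases}\log\Big({\bf u}(t)\exp\big(\tfrac{1}{2\tilde\eta}r(t)^2\big)\Big) & L=2,\\ {\bf u}(t)^{\odot(2-L)}\exp\big(\tfrac{2-L}{2\tilde\eta}r(t)^2\big) & L\neq2\end{cases}$$ is constant in $t\ge0$.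
   Context: $\odot$ denotes entrywise product/power, $\log$ acts entrywise; ${\bf A}^\dagger$ is the Moore–Penrose pseudoinverse. Loss: $\mathcal L({\bf x})=\frac{1}{2L}\|{\bf A}{\bf x}^{\odot L}-{\bf b}\|_2^2$. Weight-normalized loss $\tilde{\mathcal L}(r,{\bf u})=\mathcal L\big(\frac{r}{\|{\bf u}\|_2}{\bf u}\big)$ for $r\in\mathbb R$, ${\bf u}\in\mathbb R^N\setminus\{0\}$. Weight-normalized gradient flow: $\partial_t r=-\eta_r\nabla_r\tilde{\mathcal L}(r,{\bf u})$, $\partial_t{\bf u}=-\eta_{\bf u}\nabla_{\bf u}\tilde{\mathcal L}(r,{\bf u})$, $r(0)=r_0$, ${\bf u}(0)={\bf u}_0$. *)

theory Defs
  imports "HOL-Analysis.Analysis"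
begin

text \<open>Moore--Penrose pseudoinverse, defined by the four Penrose conditions
  (it exists and is unique for every real matrix).\<close>
definition pinv :: "real^'n^'m \<Rightarrow> real^'m^'n" where
  "pinv A = (THE X. A ** X ** A = A \<and> X ** A ** X = X \<and>
                   transpose (A ** X) = A ** X \<and> transpose (X ** A) = X ** A)"

text \<open>Entrywise power x^{\<odot>L}.\<close>
definition epow :: "real^'n \<Rightarrow> nat \<Rightarrow> real^'n" where
  "epow x L = (\<chi> i. (x $ i) ^ L)"

text \<open>Loss L(x) = 1/(2L) * ||A x^{\<odot>L} - b||^2.\<close>
definition loss :: "real^'n^'m \<Rightarrow> real^'m \<Rightarrow> nat \<Rightarrow> real^'n \<Rightarrow> real" where
  "loss A b L x = 1 / (2 * real L) * (norm (A *v epow x L - b))\<^sup>2"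

text \<open>Weight-normalized loss.\<close>
definition wnloss :: "real^'n^'m \<Rightarrow> real^'m \<Rightarrow> nat \<Rightarrow> real \<Rightarrow> real^'n \<Rightarrow> real" where
  "wnloss A b L r u = loss A b L ((r / norm u) *\<^sub>R u)"

text \<open>The quantity h_eta(t) (given r(t), u(t)).\<close>
definition hq :: "real^'n^'m \<Rightarrow> nat \<Rightarrow> real \<Rightarrow> real \<Rightarrow> real^'n \<Rightarrow> real^'n" where
  "hq A L eta r u = (mat 1 - pinv A ** A) *v
     (if L = 2 then (\<chi> i. ln (u $ i * exp (r\<^sup>2 / (2 * eta))))
      else (\<chi> i. (u $ i) powr (2 - real L) * exp ((2 - real L) / (2 * eta) * r\<^sup>2)))"

end

theory Submission
  imports Defs
begin

(* Write E = exp (r^2 / (2 eta)) and rho = A (r u)^L - b with the entrywise power. Along the flow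
   the rescaled coordinates z_i = u_i E satisfy z_i' = - r^L u_i^(L-1) E (A^T rho)_i: the radial
   part r <grad, u> u_i of the u-flow is cancelled exactly by the change of E caused by
   r' = - eta <grad, u>. This uses norm u = 1, which the flow preserves because the u-gradient of a
   scale-invariant loss is orthogonal to u. Applying ln (L = 2) or z |-> z^(2-L) turns the
   coordinate-dependent factor u_i^(L-1) into a scalar common to all coordinates, so the vector
   inside h moves within the row space of A, which I - A^+ A annihilates. *)

section \<open>The Moore--Penrose pseudoinverse\<close>

(* Keep row-space vectors in the form transpose A *v w instead of w v* A. *)
declare transpose_matrix_vector [simp del]

definition penrose :: "real^'n^'m \<Rightarrow> real^'m^'n \<Rightarrow> bool" where
  "penrose A X \<longleftrightarrow> A ** X ** A = A \<and> X ** A ** X = X \<and>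
                   transpose (A ** X) = A ** X \<and> transpose (X ** A) = X ** A"

lemma penrose_unique:
  assumes "penrose A X" "penrose A Y" shows "X = Y"
proof -
  have x2: "X ** A ** X = X" and x3: "transpose (A ** X) = A ** X"
    and y2: "Y ** A ** Y = Y" and y4: "transpose (Y ** A) = Y ** A"
    using assms by (auto simp: penrose_def)
  have AY: "transpose A = transpose A ** (A ** Y)"
    using assms by (metis penrose_def matrix_transpose_mul matrix_mul_assoc)
  have XA: "transpose A = (X ** A) ** transpose A"
    using assms by (metis penrose_def matrix_transpose_mul matrix_mul_assoc)
  have "X = X ** (A ** X)" using x2 by (simp add: matrix_mul_assoc)
  also have "\<dots> = X ** (transpose X ** (transpose A ** (A ** Y)))"
    using x3 AY by (metis matrix_transpose_mul)
  also have "\<dots> = X ** (transpose (A ** X) ** (A ** Y))"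
    by (simp add: matrix_transpose_mul matrix_mul_assoc)
  also have "\<dots> = X ** A ** Y" using x2 x3 by (simp add: matrix_mul_assoc)
  also have "\<dots> = (((X ** A) ** transpose A) ** transpose Y) ** Y"
    using XA y2 y4 by (metis matrix_transpose_mul matrix_mul_assoc)
  also have "\<dots> = (X ** A) ** (transpose (Y ** A) ** Y)"
    by (simp add: matrix_transpose_mul matrix_mul_assoc)
  also have "\<dots> = Y" using XA y2 y4 by (metis matrix_transpose_mul matrix_mul_assoc)
  finally show ?thesis .
qed

lemma inner_transpose_matrix: "inner (transpose A *v w) v = inner w (A *v (v::real^'n))"
  by (simp add: transpose_matrix_vector dot_lmul_matrix)

lemma transpose_eq_self_if_orthogonal_projection:
  fixes M :: "real^'n^'n"
  assumes "\<And>x y. inner (M *v x) (y - M *v y) = 0"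
  shows "transpose M = M"
proof -
  have sym: "inner (M *v x) y = inner x (M *v y)" for x y
  proof -
    have "inner (M *v x) y = inner (M *v x) (M *v y)"
      using assms[of x y] by (simp add: inner_diff_right)
    also have "\<dots> = inner x (M *v y)"
      using assms[of y x] by (simp add: inner_diff_right inner_commute)
    finally show ?thesis .
  qed
  have "inner x (transpose M *v y) = inner x (M *v y)" for x y
    using sym[of x y] inner_transpose_matrix[of M y x] by (simp add: inner_commute)
  then show ?thesis
    unfolding matrix_eq by (metis vector_eq_ldot)
qed

lemma transpose_mult_eq_zero_imp:
  fixes A :: "real^'n^'m"
  assumes "transpose A *v (A *v x) = 0" shows "A *v x = 0"
  using inner_transpose_matrix[of A "A *v x" x] assms by simp

lemma orthogonal_range_imp_transpose_eq_zero:
  fixes A :: "real^'n^'m"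
  assumes "\<And>x. orthogonal y (A *v x)" shows "transpose A *v y = 0"
  using assms[of "transpose A *v y"] inner_transpose_matrix[of A y "transpose A *v y"]
  by (simp add: orthogonal_def inner_commute)

lemma span_range_matrix: "span (range ((*v) A)) = range ((*v) (A::real^'n^'m))"
  by (simp add: span_eq_iff linear_subspace_image[OF matrix_vector_mul_linear subspace_UNIV])

lemma row_space_inter_kernel:
  fixes A :: "real^'n^'m"
  assumes "x \<in> range ((*v) (transpose A))" "A *v x = 0" shows "x = 0"
proof -
  obtain w where "x = transpose A *v w" using assms(1) by blast
  then have "inner x x = inner w (A *v x)" by (simp only: inner_transpose_matrix)
  then show ?thesis using assms(2) by simp
qed

definition min_norm_lsq :: "real^'n^'m \<Rightarrow> real^'m \<Rightarrow> real^'n" where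
  "min_norm_lsq A y = (THE x. x \<in> range ((*v) (transpose A)) \<and>
                              transpose A *v (A *v x) = transpose A *v y)"

lemma normal_equation_solvable:
  fixes A :: "real^'n^'m"
  shows "\<exists>x \<in> range ((*v) (transpose A)). transpose A *v (A *v x) = transpose A *v y"
proof -
  obtain a c where a: "a \<in> range ((*v) A)" and c: "\<And>x. orthogonal c (A *v x)"
    and yac: "y = a + c"
  proof (rule orthogonal_subspace_decomp_exists[of "range ((*v) A)" y])
    fix a c assume "a \<in> span (range ((*v) A))" "\<And>w. w \<in> span (range ((*v) A)) \<Longrightarrow> orthogonal c w"
      "y = a + c"
    then show thesis using that[of a c] by (auto simp: span_range_matrix)
  qed
  obtain z where z: "a = A *v z" using a by blast
  obtain x x' where x: "x \<in> range ((*v) (transpose A))"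
    and x': "\<And>w. orthogonal x' (transpose A *v w)" and zx: "z = x + x'"
  proof (rule orthogonal_subspace_decomp_exists[of "range ((*v) (transpose A))" z])
    fix x x' assume "x \<in> span (range ((*v) (transpose A)))"
      "\<And>w. w \<in> span (range ((*v) (transpose A))) \<Longrightarrow> orthogonal x' w" "z = x + x'"
    then show thesis using that[of x x'] by (auto simp: span_range_matrix)
  qed
  have "A *v x' = 0"
    using orthogonal_range_imp_transpose_eq_zero[OF x'] by simp
  then have "A *v x = a" using z zx by (simp add: matrix_vector_right_distrib)
  moreover have "transpose A *v c = 0" by (rule orthogonal_range_imp_transpose_eq_zero[OF c])
  ultimately have "transpose A *v (A *v x) = transpose A *v y"
    using yac by (simp add: matrix_vector_right_distrib)
  then show ?thesis using x by blast
qed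

lemma normal_equation_unique:
  fixes A :: "real^'n^'m"
  assumes "x \<in> range ((*v) (transpose A))" "transpose A *v (A *v x) = transpose A *v y"
    and "x' \<in> range ((*v) (transpose A))" "transpose A *v (A *v x') = transpose A *v y"
  shows "x = x'"
proof -
  obtain w w' where "x = transpose A *v w" "x' = transpose A *v w'" using assms(1,3) by blast
  then have "x - x' = transpose A *v (w - w')"
    by (simp add: matrix_vector_mult_diff_distrib)
  then have row: "x - x' \<in> range ((*v) (transpose A))" by blast
  have "transpose A *v (A *v (x - x')) = 0"
    using assms(2,4) by (simp add: matrix_vector_mult_diff_distrib)
  then have "A *v (x - x') = 0" by (rule transpose_mult_eq_zero_imp)
  with row have "x - x' = 0" by (rule row_space_inter_kernel)
  then show ?thesis by simp
qed

lemma min_norm_lsq: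
  fixes A :: "real^'n^'m"
  shows "min_norm_lsq A y \<in> range ((*v) (transpose A))"
    and "transpose A *v (A *v min_norm_lsq A y) = transpose A *v y"
proof -
  obtain x where "x \<in> range ((*v) (transpose A))" "transpose A *v (A *v x) = transpose A *v y"
    using normal_equation_solvable by blast
  then have "\<exists>!x. x \<in> range ((*v) (transpose A)) \<and> transpose A *v (A *v x) = transpose A *v y"
    using normal_equation_unique[of _ A y] by blast
  from theI'[OF this] show "min_norm_lsq A y \<in> range ((*v) (transpose A))"
    and "transpose A *v (A *v min_norm_lsq A y) = transpose A *v y"
    unfolding min_norm_lsq_def by blast+
qed

lemma min_norm_lsq_eqI:
  fixes A :: "real^'n^'m"
  assumes "x \<in> range ((*v) (transpose A))" "transpose A *v (A *v x) = transpose A *v y"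
  shows "min_norm_lsq A y = x"
  using normal_equation_unique[OF min_norm_lsq assms] .

lemma linear_min_norm_lsq: "linear (min_norm_lsq (A::real^'n^'m))"
proof (rule linearI)
  have sub: "subspace (range ((*v) (transpose A)))"
    by (rule linear_subspace_image[OF matrix_vector_mul_linear subspace_UNIV])
  show "min_norm_lsq A (y + z) = min_norm_lsq A y + min_norm_lsq A z" for y z
    using min_norm_lsq[of A y] min_norm_lsq[of A z]
    by (intro min_norm_lsq_eqI) (auto simp: matrix_vector_right_distrib subspace_add[OF sub])
  show "min_norm_lsq A (c *\<^sub>R y) = c *\<^sub>R min_norm_lsq A y" for c y
    using min_norm_lsq[of A y]
    by (intro min_norm_lsq_eqI) (auto simp: matrix_vector_mult_scaleR subspace_scale[OF sub])
qed

lemma penrose_min_norm_lsq: "penrose A (matrix (min_norm_lsq (A::real^'n^'m)))"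
proof -
  define f where "f = min_norm_lsq A"
  have X: "matrix f *v y = f y" for y
    unfolding f_def by (simp add: matrix_works linear_min_norm_lsq)
  have row: "f y \<in> range ((*v) (transpose A))" and normal: "transpose A *v (A *v f y - y) = 0" for y
    using min_norm_lsq[of A y] by (simp_all add: f_def matrix_vector_mult_diff_distrib)
  have AfA: "A *v f (A *v x) = A *v x" for x
  proof -
    have "transpose A *v (A *v (f (A *v x) - x)) = 0"
      using normal[of "A *v x"] by (simp add: matrix_vector_mult_diff_distrib)
    then have "A *v (f (A *v x) - x) = 0" by (rule transpose_mult_eq_zero_imp)
    then show ?thesis by (simp add: matrix_vector_mult_diff_distrib)
  qed
  have fAf: "f (A *v f y) = f y" for y
    unfolding f_def by (rule min_norm_lsq_eqI) (use row[of y] in \<open>simp_all add: f_def\<close>)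
  have orth_Af: "inner (A *v f x) (y - A *v f y) = 0" for x y
    using normal[of y] inner_transpose_matrix[of A "y - A *v f y" "f x"]
    by (simp add: inner_commute matrix_vector_mult_diff_distrib)
  have orth_fA: "inner (f (A *v x)) (y - f (A *v y)) = 0" for x y
  proof -
    obtain w where "f (A *v x) = transpose A *v w" using row by blast
    then show ?thesis
      using AfA[of y] by (simp add: inner_transpose_matrix matrix_vector_mult_diff_distrib)
  qed
  show ?thesis
    unfolding penrose_def f_def[symmetric]
  proof (intro conjI)
    show "A ** matrix f ** A = A"
      by (simp add: matrix_eq matrix_vector_mul_assoc[symmetric] X AfA)
    show "matrix f ** A ** matrix f = matrix f"
      by (simp add: matrix_eq matrix_vector_mul_assoc[symmetric] X fAf)
    show "transpose (A ** matrix f) = A ** matrix f"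
      by (rule transpose_eq_self_if_orthogonal_projection)
        (simp add: matrix_vector_mul_assoc[symmetric] X orth_Af)
    show "transpose (matrix f ** A) = matrix f ** A"
      by (rule transpose_eq_self_if_orthogonal_projection)
        (simp add: matrix_vector_mul_assoc[symmetric] X orth_fA)
  qed
qed

lemma penrose_pinv: "penrose A (pinv A)"
proof -
  have "\<exists>!X. penrose A X" using penrose_min_norm_lsq penrose_unique by blast
  then show ?thesis unfolding pinv_def penrose_def[symmetric] by (rule theI')
qed

lemma pinv_mult_transpose: "pinv A ** A ** transpose A = transpose A"
proof -
  have "pinv A ** A ** transpose A = transpose (A ** (pinv A ** A))"
    using penrose_pinv[of A] by (simp add: penrose_def matrix_transpose_mul)
  also have "\<dots> = transpose A"
    using penrose_pinv[of A] by (simp add: penrose_def matrix_mul_assoc)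
  finally show ?thesis .
qed

lemma pinv_complement_mult_transpose:
  "(mat 1 - pinv A ** A) *v (transpose A *v w) = 0"
proof -
  have "(pinv A ** A) *v (transpose A *v w) = transpose A *v w"
    by (simp add: matrix_vector_mul_assoc pinv_mult_transpose)
  then show ?thesis by (simp add: matrix_vector_mult_diff_rdistrib)
qed

section \<open>Gradients of the weight-normalized loss\<close>

definition loss_grad :: "real^'n^'m \<Rightarrow> real^'m \<Rightarrow> nat \<Rightarrow> real^'n \<Rightarrow> real^'n" where
  "loss_grad A b L x = (\<chi> i. x $ i ^ (L - 1) * (transpose A *v (A *v epow x L - b)) $ i)"

lemma epow_has_derivative:
  fixes x :: "real^'n"
  shows "((\<lambda>x. epow x L) has_derivative (\<lambda>h. \<chi> i. real L * x $ i ^ (L - 1) * h $ i)) (at x within S)"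
proof (rule has_derivative_componentwise_within[THEN iffD2], intro ballI)
  fix e :: "real^'n" assume "e \<in> Basis"
  then obtain j where e: "e = axis j 1" by (auto simp: Basis_vec_def)
  have "((\<lambda>y. y $ j ^ L) has_derivative (\<lambda>h. real L * h $ j * x $ j ^ (L - 1))) (at x within S)"
    by (rule has_derivative_power[OF bounded_linear.has_derivative[OF bounded_linear_vec_nth has_derivative_ident]])
  then show "((\<lambda>y. epow y L \<bullet> e) has_derivative
      (\<lambda>h. (\<chi> i. real L * x $ i ^ (L - 1) * h $ i) \<bullet> e)) (at x within S)"
    by (simp add: e epow_def cart_eq_inner_axis[symmetric] mult_ac)
qed

lemma loss_has_derivative:
  fixes A :: "real^'n^'m"
  assumes "L \<ge> 1"
  shows "(loss A b L has_derivative (\<lambda>h. inner (loss_grad A b L x) h)) (at x within S)"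
proof -
  define res where "res = A *v epow x L - b"
  define E where "E h = (\<chi> i. real L * x $ i ^ (L - 1) * h $ i)" for h :: "real^'n"
  have "((\<lambda>x. A *v epow x L - b) has_derivative (\<lambda>h. A *v E h)) (at x within S)"
    unfolding E_def
    using has_derivative_diff[OF bounded_linear.has_derivative[OF matrix_vector_mul_bounded_linear
        epow_has_derivative] has_derivative_const]
    by simp
  then have "(loss A b L has_derivative
      (\<lambda>h. 1 / (2 * real L) * (inner res (A *v E h) + inner (A *v E h) res))) (at x within S)"
    unfolding loss_def power2_norm_eq_inner res_def
    by (intro has_derivative_mult_right has_derivative_inner)
  moreover have "1 / (2 * real L) * (inner res (A *v E h) + inner (A *v E h) res)
      = inner (loss_grad A b L x) h" for h
  proof -
    have "1 / (2 * real L) * (inner res (A *v E h) + inner (A *v E h) res)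
        = inner (transpose A *v res) (E h) / real L"
      by (simp only: inner_commute[of "A *v E h" res] inner_transpose_matrix) simp
    also have "\<dots> = inner (loss_grad A b L x) h"
      using assms by (simp add: inner_vec_def E_def loss_grad_def res_def sum_divide_distrib mult_ac)
    finally show ?thesis .
  qed
  ultimately show ?thesis by simp
qed

lemma normalize_has_derivative:
  fixes v :: "'a::real_inner"
  assumes "v \<noteq> 0"
  shows "((\<lambda>w. (r / norm w) *\<^sub>R w) has_derivative
     (\<lambda>h. (r / norm v) *\<^sub>R h - (r * inner v h / norm v ^ 3) *\<^sub>R v)) (at v)"
proof -
  have "(norm has_derivative (\<lambda>h. inner h (sgn v))) (at v)"
    using has_derivative_norm[OF assms] by simp
  then show ?thesis
    using assms
    by (auto intro!: derivative_eq_intros simp: sgn_div_norm inner_commute algebra_simps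
        power3_eq_cube divide_simps)
qed

lemma wnloss_grad_u:
  fixes A :: "real^'n^'m" and v g :: "real^'n"
  assumes "L \<ge> 1" "v \<noteq> 0"
    and "((\<lambda>w. wnloss A b L r w) has_derivative (\<lambda>h. inner g h)) (at v)"
  defines "G \<equiv> loss_grad A b L ((r / norm v) *\<^sub>R v)"
  shows "g = (r / norm v) *\<^sub>R G - (r * inner G v / norm v ^ 3) *\<^sub>R v"
proof -
  have "((\<lambda>w. wnloss A b L r w) has_derivative
      (\<lambda>h. inner G ((r / norm v) *\<^sub>R h - (r * inner v h / norm v ^ 3) *\<^sub>R v))) (at v)"
    unfolding wnloss_def G_def
    by (rule has_derivative_compose[OF normalize_has_derivative loss_has_derivative]) fact+
  with assms(3) have eq: "(\<lambda>h. inner g h)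
      = (\<lambda>h. inner G ((r / norm v) *\<^sub>R h - (r * inner v h / norm v ^ 3) *\<^sub>R v))"
    by (rule has_derivative_unique)
  then have "inner g h = inner ((r / norm v) *\<^sub>R G - (r * inner G v / norm v ^ 3) *\<^sub>R v) h" for h
    using fun_cong[OF eq, of h] by (simp add: inner_diff_left inner_diff_right inner_commute)
  then show ?thesis by (metis vector_eq_rdot)
qed

lemma wnloss_grad_r:
  fixes A :: "real^'n^'m" and v :: "real^'n"
  assumes "L \<ge> 1" "v \<noteq> 0"
    and "((\<lambda>s. wnloss A b L s v) has_real_derivative g) (at r)"
  shows "g = inner (loss_grad A b L ((r / norm v) *\<^sub>R v)) v / norm v"
proof -
  have "((\<lambda>s. (s / norm v) *\<^sub>R v) has_derivative (\<lambda>k. (k / norm v) *\<^sub>R v)) (at r)"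
    using assms(2) by (auto intro!: derivative_eq_intros)
  then have "((\<lambda>s. wnloss A b L s v) has_derivative
      (\<lambda>k. inner (loss_grad A b L ((r / norm v) *\<^sub>R v)) ((k / norm v) *\<^sub>R v))) (at r)"
    unfolding wnloss_def by (rule has_derivative_compose[OF _ loss_has_derivative[OF assms(1)]])
  moreover have "((\<lambda>s. wnloss A b L s v) has_derivative (\<lambda>k. g * k)) (at r)"
    using assms(3) by (simp add: has_field_derivative_def)
  ultimately have "(\<lambda>k. g * k) = (\<lambda>k. inner (loss_grad A b L ((r / norm v) *\<^sub>R v)) ((k / norm v) *\<^sub>R v))"
    using has_derivative_unique by blast
  from fun_cong[OF this, of 1] show ?thesis by simp
qed

lemma wnloss_grad_u_orthogonal:
  fixes A :: "real^'n^'m" and v g :: "real^'n"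
  assumes "L \<ge> 1" "v \<noteq> 0"
    and "((\<lambda>w. wnloss A b L r w) has_derivative (\<lambda>h. inner g h)) (at v)"
  shows "inner v g = 0"
proof -
  have "inner v v = norm v ^ 2" by (simp add: power2_norm_eq_inner)
  then show ?thesis
    using assms(2) unfolding wnloss_grad_u[OF assms]
    by (simp add: inner_diff_right inner_commute power2_eq_square power3_eq_cube)
qed

lemma wnloss_grad_u_unit_nth:
  fixes A :: "real^'n^'m" and v g :: "real^'n"
  assumes "L \<ge> 1" "norm v = 1"
    and "((\<lambda>w. wnloss A b L r w) has_derivative (\<lambda>h. inner g h)) (at v)"
  shows "g $ k = r ^ L * v $ k ^ (L - 1) * (transpose A *v (A *v epow (r *\<^sub>R v) L - b)) $ k
    - r * inner (loss_grad A b L (r *\<^sub>R v)) v * v $ k"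
proof -
  have "v \<noteq> 0" using assms(2) by auto
  have "r * (r * v $ k) ^ (L - 1) = r ^ L * v $ k ^ (L - 1)"
    using assms(1) by (cases L) (simp_all add: power_mult_distrib)
  then show ?thesis
    using wnloss_grad_u[OF assms(1) \<open>v \<noteq> 0\<close> assms(3)] assms(2)
    by (simp add: loss_grad_def mult.assoc[symmetric])
qed

section \<open>The conserved quantity\<close>

lemma has_vector_derivative_vec_nth:
  assumes "(u has_vector_derivative u') F"
  shows "((\<lambda>s. u s $ k) has_real_derivative u' $ k) F"
  using bounded_linear.has_vector_derivative[OF bounded_linear_vec_nth assms]
  by (simp add: has_real_derivative_iff_has_vector_derivative)

lemma norm_constant_if_derivative_orthogonal:
  fixes u u' :: "real \<Rightarrow> 'a::real_inner"
  assumes deriv: "\<And>t. t \<ge> 0 \<Longrightarrow> (u has_vector_derivative u' t) (at t within {0..})"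
    and orth: "\<And>t. t \<ge> 0 \<Longrightarrow> inner (u t) (u' t) = 0"
    and "t \<ge> 0"
  shows "norm (u t) = norm (u 0)"
proof -
  have "((\<lambda>s. inner (u s) (u s)) has_real_derivative 0) (at s within {0..})" if "s \<in> {0..}" for s
  proof -
    have du: "(u has_derivative (\<lambda>h. h *\<^sub>R u' s)) (at s within {0..})"
      using deriv that by (simp add: has_vector_derivative_def)
    show ?thesis
      unfolding has_field_derivative_def
      by (rule has_derivative_eq_rhs[OF has_derivative_inner[OF du du]])
        (use orth that in \<open>simp add: inner_commute fun_eq_iff\<close>)
  qed
  then obtain c where "\<And>s. s \<in> {0..} \<Longrightarrow> inner (u s) (u s) = c"
    using has_field_derivative_zero_constant[of "{0..}" "\<lambda>s. inner (u s) (u s)"] by auto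
  then have "inner (u t) (u t) = inner (u 0) (u 0)" using \<open>t \<ge> 0\<close> by simp
  then show ?thesis by (simp add: norm_eq_sqrt_inner)
qed

lemma pinv_complement_constant:
  fixes A :: "real^'n^'m" and w :: "real \<Rightarrow> 'n \<Rightarrow> real"
    and c :: "real \<Rightarrow> real" and g :: "real \<Rightarrow> real^'m"
  assumes deriv: "\<And>t k. t \<ge> 0 \<Longrightarrow>
      ((\<lambda>s. w s k) has_real_derivative c t * (transpose A *v g t) $ k) (at t within {0..})"
    and "t \<ge> 0"
  shows "(mat 1 - pinv A ** A) *v (\<chi> k. w t k) = (mat 1 - pinv A ** A) *v (\<chi> k. w 0 k)"
proof -
  define P where "P = mat 1 - pinv A ** A"
  have "((\<lambda>s. (P *v (\<chi> k. w s k)) $ j) has_real_derivative 0) (at t within {0..})"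
    if "t \<in> {0..}" for t j
  proof -
    have D: "((\<lambda>s. \<Sum>k\<in>UNIV. P $ j $ k * w s k) has_real_derivative
        (\<Sum>k\<in>UNIV. P $ j $ k * (c t * (transpose A *v g t) $ k))) (at t within {0..})"
      using that by (intro DERIV_sum DERIV_cmult deriv) simp
    have "(\<Sum>k\<in>UNIV. P $ j $ k * (c t * (transpose A *v g t) $ k))
        = c t * (P *v (transpose A *v g t)) $ j"
      by (simp add: matrix_vector_mult_def sum_distrib_left mult_ac)
    also have "P *v (transpose A *v g t) = 0"
      unfolding P_def by (rule pinv_complement_mult_transpose)
    finally have "(\<Sum>k\<in>UNIV. P $ j $ k * (c t * (transpose A *v g t) $ k)) = 0" by simp
    moreover have "(\<lambda>s. (P *v (\<chi> k. w s k)) $ j) = (\<lambda>s. \<Sum>k\<in>UNIV. P $ j $ k * w s k)"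
      by (simp add: matrix_vector_mult_def)
    ultimately show ?thesis using D by simp
  qed
  then have "(P *v (\<chi> k. w t k)) $ j = (P *v (\<chi> k. w 0 k)) $ j" for j
    using has_field_derivative_zero_constant[of "{0..}" "\<lambda>s. (P *v (\<chi> k. w s k)) $ j"] \<open>t \<ge> 0\<close>
    by fastforce
  then show ?thesis unfolding P_def by (simp add: vec_eq_iff)
qed

definition log_or_powr :: "nat \<Rightarrow> real \<Rightarrow> real" where
  "log_or_powr L x = (if L = 2 then ln x else x powr (2 - real L))"

lemma log_or_powr_has_derivative:
  assumes "x > 0"
  shows "(log_or_powr L has_real_derivative
      (if L = 2 then 1 else 2 - real L) * x powr (1 - real L)) (at x)"
proof (cases "L = 2")
  case True
  then have "log_or_powr L = ln" by (simp add: log_or_powr_def fun_eq_iff)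
  then show ?thesis
    using True DERIV_ln_divide[OF assms] assms by (simp add: powr_minus_divide)
next
  case False
  then have "log_or_powr L = (\<lambda>z. z powr (2 - real L))" by (simp add: log_or_powr_def fun_eq_iff)
  then show ?thesis
    using False has_real_derivative_powr[OF assms, of "2 - real L"] by simp
qed

lemma hq_eq_log_or_powr:
  assumes "\<And>i. u $ i > 0"
  shows "hq A L eta r u
    = (mat 1 - pinv A ** A) *v (\<chi> i. log_or_powr L (u $ i * exp (r\<^sup>2 / (2 * eta))))"
proof -
  have "(u $ i * exp (r\<^sup>2 / (2 * eta))) powr (2 - real L)
      = u $ i powr (2 - real L) * exp ((2 - real L) / (2 * eta) * r\<^sup>2)" for i
    using assms[of i] by (simp add: powr_def ln_mult distrib_left exp_add)
  then show ?thesis by (simp add: hq_def log_or_powr_def)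
qed

lemma rescaled_coordinate_has_derivative:
  fixes x r :: "real \<Rightarrow> real"
  assumes "eta \<noteq> 0"
    and "(x has_real_derivative (r t * c * x t - r t ^ L * x t ^ (L - 1) * g)) (at t within S)"
    and "(r has_real_derivative (- eta * c)) (at t within S)"
  shows "((\<lambda>s. x s * exp ((r s)\<^sup>2 / (2 * eta))) has_real_derivative
      - (r t ^ L * x t ^ (L - 1) * exp ((r t)\<^sup>2 / (2 * eta)) * g)) (at t within S)"
  using assms
  by (auto intro!: derivative_eq_intros simp: field_simps power2_eq_square)

lemma log_or_powr_rescaled_coordinate_has_derivative:
  fixes x r :: "real \<Rightarrow> real"
  assumes "L \<ge> 1" "eta \<noteq> 0" "x t > 0"
    and "(x has_real_derivative (r t * c * x t - r t ^ L * x t ^ (L - 1) * g)) (at t within S)"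
    and "(r has_real_derivative (- eta * c)) (at t within S)"
  shows "((\<lambda>s. log_or_powr L (x s * exp ((r s)\<^sup>2 / (2 * eta)))) has_real_derivative
      - ((if L = 2 then 1 else 2 - real L) * exp ((r t)\<^sup>2 / (2 * eta)) powr (2 - real L) * r t ^ L)
        * g) (at t within S)"
proof -
  define E where "E = exp ((r t)\<^sup>2 / (2 * eta))"
  define \<kappa> where "\<kappa> = (if L = 2 then 1 else 2 - real L)"
  have "x t * E > 0" using assms(3) by (simp add: E_def)
  \<comment> \<open>the dependence on the coordinate \<open>x t\<close> cancels here\<close>
  have E: "(x t * E) powr (1 - real L) * (x t ^ (L - 1) * E) = E powr (2 - real L)"
  proof -
    have "E powr (1 - real L) * E = E powr (1 - real L) * E powr 1"
      by (simp add: E_def)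
    also have "\<dots> = E powr (1 - real L + 1)"
      by (simp only: powr_add)
    finally have "E powr (1 - real L) * E = E powr (2 - real L)" by simp
    moreover have "x t powr (1 - real L) * x t ^ (L - 1) = 1"
      using assms(1,3) by (simp add: powr_realpow[symmetric] powr_add[symmetric] of_nat_diff)
    ultimately show ?thesis
      using assms(3) by (simp add: E_def powr_mult algebra_simps)
  qed
  have D: "((\<lambda>s. log_or_powr L (x s * exp ((r s)\<^sup>2 / (2 * eta)))) has_real_derivative
      \<kappa> * (x t * E) powr (1 - real L) * - (r t ^ L * x t ^ (L - 1) * E * g)) (at t within S)"
    unfolding \<kappa>_def E_def
    by (rule DERIV_chain2[OF log_or_powr_has_derivative rescaled_coordinate_has_derivative[OF assms(2,4,5)]])
      (use \<open>x t * E > 0\<close> in \<open>simp add: E_def\<close>)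
  have "\<kappa> * (x t * E) powr (1 - real L) * - (r t ^ L * x t ^ (L - 1) * E * g)
      = - (\<kappa> * ((x t * E) powr (1 - real L) * (x t ^ (L - 1) * E)) * r t ^ L) * g"
    by (simp add: mult_ac)
  also have "\<dots> = - (\<kappa> * E powr (2 - real L) * r t ^ L) * g"
    by (simp only: E)
  finally show ?thesis
    using DERIV_cong[OF D] unfolding \<kappa>_def E_def by blast
qed

theorem mainTheorem10:
  fixes A :: "real^'n^'m" and b :: "real^'m" and L :: nat and eta :: real
    and r :: "real \<Rightarrow> real" and u :: "real \<Rightarrow> real^'n"
    and gr :: "real \<Rightarrow> real" and gu :: "real \<Rightarrow> real^'n"
  assumes L_pos: "L \<ge> 1"
    and eta_pos: "eta > 0"
    and grad_r: "\<And>t. t \<ge> 0 \<Longrightarrow>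
        ((\<lambda>s. wnloss A b L s (u t)) has_real_derivative gr t) (at (r t))"
    and grad_u: "\<And>t. t \<ge> 0 \<Longrightarrow>
        ((\<lambda>v. wnloss A b L (r t) v) has_derivative (\<lambda>h. gu t \<bullet> h)) (at (u t))"
    and flow_r: "\<And>t. t \<ge> 0 \<Longrightarrow> (r has_real_derivative (- eta * gr t)) (at t within {0..})"
    and flow_u: "\<And>t. t \<ge> 0 \<Longrightarrow> (u has_vector_derivative (- gu t)) (at t within {0..})"
    and u0_norm: "norm (u 0) = 1"
    and u_pos: "\<And>t i. t \<ge> 0 \<Longrightarrow> u t $ i > 0"
  shows "\<forall>t\<ge>0. hq A L eta (r t) (u t) = hq A L eta (r 0) (u 0)"
proof (intro allI impI)
  have u_ne: "u t \<noteq> 0" if "t \<ge> 0" for t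
    using u_pos[OF that, of undefined] by auto
  have unit: "norm (u t) = 1" if "t \<ge> 0" for t
    using norm_constant_if_derivative_orthogonal[of u "\<lambda>t. - gu t", OF flow_u _ that]
      wnloss_grad_u_orthogonal[OF L_pos u_ne grad_u] u0_norm by simp
  define res where "res t = A *v epow (r t *\<^sub>R u t) L - b" for t
  define c where "c t = inner (loss_grad A b L (r t *\<^sub>R u t)) (u t)" for t
  have dr: "(r has_real_derivative (- eta * c t)) (at t within {0..})" if "t \<ge> 0" for t
    using flow_r[OF that] wnloss_grad_r[OF L_pos u_ne[OF that] grad_r[OF that]] unit[OF that]
    by (simp add: c_def)
  have du: "((\<lambda>s. u s $ k) has_real_derivative
      (r t * c t * u t $ k - r t ^ L * u t $ k ^ (L - 1) * (transpose A *v res t) $ k))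
      (at t within {0..})" if "t \<ge> 0" for t k
    using has_vector_derivative_vec_nth[OF flow_u[OF that], of k]
      wnloss_grad_u_unit_nth[OF L_pos unit[OF that] grad_u[OF that], of k]
    by (simp add: c_def res_def)
  define rate where "rate t = - ((if L = 2 then 1 else 2 - real L)
      * exp ((r t)\<^sup>2 / (2 * eta)) powr (2 - real L) * r t ^ L)" for t
  have deriv: "((\<lambda>s. log_or_powr L (u s $ k * exp ((r s)\<^sup>2 / (2 * eta)))) has_real_derivative
      rate t * (transpose A *v res t) $ k) (at t within {0..})" if "t \<ge> 0" for t k
    unfolding rate_def using eta_pos
    by (intro log_or_powr_rescaled_coordinate_has_derivative[OF L_pos _ u_pos du dr] that) simp
  fix t :: real assume "t \<ge> 0"
  from pinv_complement_constant[OF deriv this]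
  show "hq A L eta (r t) (u t) = hq A L eta (r 0) (u 0)"
    using u_pos \<open>t \<ge> 0\<close> by (simp add: hq_eq_log_or_powr)
qed

end
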